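(* Let $k \geq 3$ be an integer, and let $p_1, p_2, \ldots, p_{2k}$ be positive integers such that the differences $p_i - p_j$, over all ordered pairs $(i,j)$ with $i \neq j$, are all distinct. For $1 \leq i, j \leq k$, let $a_{k(i-1)+j} = |p_{2i} - p_{2j-1}|$. Then the induced subgraph of the $k^2$-dimensional grid with vertex set $$\{(x_1, x_2, \ldots, x_{k^2}) \in \mathbb{Z}^{k^2} \mid a_1 x_1 + a_2 x_2 + \cdots + a_{k^2} x_{k^2} \in \{p_1, p_2, \ldots, p_{2k}\}\}$$ is $k$-regular and has girth $12$.
   Context: The $n$-dimensional grid is the graph with vertex set $\mathbb{Z}^n$ in which two points are adjacent if and only if their Euclidean distance is $1$. The induced subgraph with a given vertex set contains an edge between any two of its vertices that are adjacent in the grid. A graph is $k$-regular if every vertex has exactly $k$ neighbours. The girth of a graph is the length of its shortest cycle.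
   Formalization: The vertex set is additionally assumed to be non-empty; otherwise the claim fails, e.g. for p_i = 2^(i+1)+1, where all p_i are odd and all a_m are even, so the vertex set is empty and the girth is not 12. *)

theory Defs
  imports "HOL-Analysis.Analysis" "Graph_Theory.Graph_Theory"
begin

text \<open>
  The dimension has to range over a term, so points of \<open>\<int>\<^sup>n\<close> are functions on the index set
  \<open>{1..n}\<close>; extensionality (value \<^term>\<open>undefined\<close> off \<open>{1..n}\<close>) makes equality of functions
  agree with equality of points.
\<close>

definition int_lattice :: "nat \<Rightarrow> (nat \<Rightarrow> int) set" where
  "int_lattice n = {1..n} \<rightarrow>\<^sub>E UNIV"

definition euclidean_distance :: "nat \<Rightarrow> (nat \<Rightarrow> int) \<Rightarrow> (nat \<Rightarrow> int) \<Rightarrow> real" where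
  "euclidean_distance n x y = L2_set (\<lambda>i. real_of_int (x i) - real_of_int (y i)) {1..n}"

text \<open>
  As usual in the graph library, a simple graph is a symmetric digraph without loops and
  multiple arcs, each undirected edge being a pair of opposite arcs.
\<close>

definition grid :: "nat \<Rightarrow> (nat \<Rightarrow> int, (nat \<Rightarrow> int) \<times> (nat \<Rightarrow> int)) pre_digraph" where
  "grid n = \<lparr> verts = int_lattice n,
              arcs = {(x, y). x \<in> int_lattice n \<and> y \<in> int_lattice n \<and> euclidean_distance n x y = 1},
              tail = fst, head = snd \<rparr>"

text \<open>The finiteness conjunct only excludes \<^term>\<open>card\<close> being 0 on infinite sets.\<close>

definition regular_graph :: "nat \<Rightarrow> ('a, 'b) pre_digraph \<Rightarrow> bool" where
  "regular_graph k G \<longleftrightarrow>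
     (\<forall>v\<in>verts G. finite {w. v \<rightarrow>\<^bsub>G\<^esub> w} \<and> card {w. v \<rightarrow>\<^bsub>G\<^esub> w} = k)"

text \<open>
  For the library, going along an edge and back is a cycle of length 2 in a symmetric digraph.
  Such walks are not cycles of the undirected simple graph, hence the bound 3. The girth of a
  graph without cycles is \<open>\<infinity>\<close>.
\<close>

definition girth :: "('a, 'b) pre_digraph \<Rightarrow> enat" where
  "girth G = (INF c \<in> {c. pre_digraph.cycle G c \<and> 3 \<le> length c}. enat (length c))"

definition level_points :: "nat \<Rightarrow> (nat \<Rightarrow> int) \<Rightarrow> int set \<Rightarrow> (nat \<Rightarrow> int) set" where
  "level_points n a P = {x \<in> int_lattice n. (\<Sum>i = 1..n. a i * x i) \<in> P}"

lemma grid_simple_graph: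
  "loopfree_digraph (grid n)" "nomulti_digraph (grid n)" "sym_digraph (grid n)"
proof -
  have wf: "wf_digraph (grid n)"
    by unfold_locales (auto simp: grid_def)
  have irrefl: "euclidean_distance n x x = 0" for x
    by (simp add: euclidean_distance_def L2_set_def)
  have sym: "euclidean_distance n x y = euclidean_distance n y x" for x y
    by (simp add: euclidean_distance_def L2_set_def power2_commute)
  show "loopfree_digraph (grid n)"
    using wf by (auto simp: loopfree_digraph_def loopfree_digraph_axioms_def grid_def irrefl)
  show "nomulti_digraph (grid n)"
    using wf by (auto simp: nomulti_digraph_def nomulti_digraph_axioms_def grid_def arc_to_ends_def)
  show "sym_digraph (grid n)"
    using wf by (auto simp: sym_digraph_def sym_digraph_axioms_def symmetric_conv grid_def sym)
qed

text \<open>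
  A set of level points may be empty: for \<open>p\<^sub>i = 2 ^ (i + 1) + 1\<close> all ordered differences are
  distinct, but every \<open>p\<^sub>i\<close> is odd while every coefficient \<open>\<bar>p\<^sub>i - p\<^sub>j\<bar>\<close> is even. A graph is
  understood to have at least one vertex, which has to be required explicitly for such sets.
\<close>

lemma level_points_empty:
  assumes "\<And>i. i \<in> {1..n} \<Longrightarrow> d dvd a i" and "\<And>q. q \<in> P \<Longrightarrow> \<not> d dvd q"
  shows "level_points n a P = {}"
proof -
  have "d dvd (\<Sum>i = 1..n. a i * x i)" for x
    using assms(1) by (intro dvd_sum dvd_mult2) auto
  then show ?thesis
    using assms(2) by (auto simp: level_points_def)
qed

end

theory Submission
  imports Defs
begin

text \<open>
  Taking levels maps the graph onto \<open>K\<^bsub>k,k\<^esub>\<close> on the indices, even against odd, and by the distinctness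
  of the differences each edge of \<open>K\<^bsub>k,k\<^esub>\<close> is traversed by changing its own coordinate by \<open>\<plusminus>1\<close>, with
  opposite signs for the two directions. Hence the map is a covering, which gives regularity, and a
  walk in \<open>K\<^bsub>k,k\<^esub>\<close> lifts to a closed walk iff it passes each edge equally often in both directions. A
  closed walk of this kind that never backtracks cannot run on a single cycle, so it has at least
  three vertices on one side of \<open>K\<^bsub>k,k\<^esub>\<close>, each with at least two edges used in both directions: 12 steps.
  A walk around \<open>K\<^bsub>2,3\<^esub>\<close> attains this bound.
\<close>

section \<open>Library cycles as vertex sequences\<close>

text \<open>The sequence runs periodically through all naturals, so later arguments can look ahead
  by a step or a whole period without boundary cases.\<close>

lemma (in wf_digraph) cycle_vertex_sequence:
  assumes "cycle c"
  shows "\<exists>v. (\<forall>t. v t \<rightarrow> v (Suc t)) \<and> (\<forall>s t. v s = v t \<longleftrightarrow> s mod length c = t mod length c)"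
proof -
  let ?n = "length c"
  obtain u where u: "awalk u c u" "distinct (tl (awalk_verts u c))" and ne: "c \<noteq> []"
    using assms by (auto simp: cycle_def)
  have cas: "cas u c u" and arcs: "set c \<subseteq> arcs G"
    using u by (auto simp: awalk_def)
  have verts: "awalk_verts u c = tail G (hd c) # map (head G) c"
    using awalk_verts_conv'[OF cas] ne by simp
  \<comment> \<open>The vertex list read by heads and by tails; comparing entries shows that each
    arc starts where the one before it ends.\<close>
  then have eq: "tail G (hd c) # map (head G) c = map (tail G) c @ [head G (last c)]"
    using ne by (simp add: awalk_verts_conv)
  have closed: "head G (last c) = tail G (hd c)"
    using cas ne awlast_if_cas[OF cas] awhd_if_cas[OF cas] by (simp add: awalk_verts_conv hd_map)
  have step: "tail G (c ! (Suc t mod ?n)) = head G (c ! (t mod ?n))" for t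
  proof (cases "Suc (t mod ?n) = ?n")
    case True
    then have "Suc t mod ?n = 0" "t mod ?n = ?n - 1"
      by (auto simp: mod_Suc)
    then show ?thesis
      using closed ne by (simp add: hd_conv_nth last_conv_nth)
  next
    case False
    have "t mod ?n < ?n" using ne by simp
    then have "Suc (t mod ?n) < ?n" and "Suc t mod ?n = Suc (t mod ?n)"
      using False by (auto simp: mod_Suc)
    then show ?thesis
      using arg_cong[OF eq, of "\<lambda>xs. xs ! Suc (t mod ?n)"] by (simp add: nth_append)
  qed
  have in_arcs: "c ! (t mod ?n) \<in> arcs G" for t
    using arcs ne by (meson length_greater_0_conv mod_less_divisor nth_mem subsetD)
  show ?thesis
  proof (intro exI conjI allI)
    fix s t
    show "head G (c ! (t mod ?n)) \<rightarrow> head G (c ! (Suc t mod ?n))"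
      using step[of t] in_arcs[of "Suc t"] by (auto simp: arcs_ends_conv intro!: image_eqI)
    have "inj_on (\<lambda>i. head G (c ! i)) {..<?n}"
      using u(2) verts by (auto simp: distinct_conv_nth inj_on_def)
    then show "head G (c ! (s mod ?n)) = head G (c ! (t mod ?n)) \<longleftrightarrow> s mod ?n = t mod ?n"
      using ne by (auto dest!: inj_onD)
  qed
qed

lemma (in wf_digraph) cycle_of_vertex_sequence:
  assumes "0 < n" and arcs: "\<And>t. t < n \<Longrightarrow> v t \<rightarrow> v (Suc t)"
    and closed: "v n = v 0" and inj: "inj_on v {..<n}"
  shows "\<exists>c. cycle c \<and> length c = n"
proof -
  have "\<forall>t. \<exists>e. t < n \<longrightarrow> e \<in> arcs G \<and> tail G e = v t \<and> head G e = v (Suc t)"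
    using arcs by (fastforce simp: arcs_ends_conv)
  then obtain e where e: "\<And>t. t < n \<Longrightarrow> e t \<in> arcs G \<and> tail G (e t) = v t \<and> head G (e t) = v (Suc t)"
    by metis
  have cas: "j \<le> n \<Longrightarrow> i \<le> j \<Longrightarrow> cas (v i) (map e [i..<j]) (v j)" for i j
  proof (induction "j - i" arbitrary: i)
    case (Suc d)
    then have "cas (v (Suc i)) (map e [Suc i..<j]) (v j)" by auto
    with Suc.prems Suc.hyps(2) e[of i] show ?case by (subst upt_rec) auto
  qed auto
  let ?c = "map e [0..<n]"
  have cas': "cas (v 0) ?c (v 0)"
    using cas[of n 0] closed by simp
  have ne: "?c \<noteq> []" using \<open>0 < n\<close> by simp
  have "v 0 \<in> verts G"
    using e[OF \<open>0 < n\<close>] by (metis tail_in_verts)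
  with cas' e have "awalk (v 0) ?c (v 0)"
    by (auto simp: awalk_def)
  moreover have "distinct (tl (awalk_verts (v 0) ?c))"
  proof -
    have "map (head G) ?c = map v [Suc 0..<Suc n]"
      using e by (simp add: map_Suc_upt[symmetric] del: upt_Suc)
    moreover have "inj_on v {Suc 0..<Suc n}"
    proof (rule inj_onI)
      fix s t assume "s \<in> {Suc 0..<Suc n}" "t \<in> {Suc 0..<Suc n}" "v s = v t"
      \<comment> \<open>The cycle predicate compares \<open>v 1\<close> up to \<open>v n\<close>,
        while \<open>inj\<close> covers \<open>v 0\<close> up to \<open>v (n - 1)\<close>;
        \<open>r\<close> replaces the index \<open>n\<close> by \<open>0\<close>.\<close>
      moreover define r where "r s = (if s = n then 0 else s)" for s
      ultimately have "v (r s) = v (r t)" "r s < n" "r t < n"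
        using closed \<open>0 < n\<close> by auto
      then have "r s = r t" using inj by (auto dest: inj_onD)
      then show "s = t"
        using \<open>s \<in> _\<close> \<open>t \<in> _\<close> by (auto simp: r_def split: if_splits)
    qed
    ultimately show ?thesis
      using awalk_verts_conv'[OF cas'] ne by (simp add: distinct_map del: upt_Suc)
  qed
  ultimately have "cycle ?c"
    using ne unfolding cycle_def by blast
  then show ?thesis by (intro exI[of _ ?c]) simp
qed

section \<open>Non-backtracking closed walks in bipartite graphs\<close>

text \<open>Arc count: every visited vertex has two out-neighbours in \<open>D\<close>, and reversal
  matches the arcs leaving one side with those leaving the other, so
  \<open>4 * card (A b) \<le> card D\<close> and \<open>card D \<le> n\<close>. One side has three
  visited vertices.\<close>

lemma nonbacktracking_two_way_walk_length:
  fixes m :: "nat \<Rightarrow> 'a" and side :: "'a \<Rightarrow> bool"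
  assumes "0 < n" and periodic: "\<And>t. m (t mod n) = m t"
    and bip: "\<And>t. side (m (Suc t)) \<longleftrightarrow> \<not> side (m t)"
    and nonback: "\<And>t. m (Suc (Suc t)) \<noteq> m t"
    and two_way: "\<And>t. \<exists>s. m s = m (Suc t) \<and> m (Suc s) = m t"
  shows "12 \<le> n"
proof -
  define D where "D = range (\<lambda>t. (m t, m (Suc t)))"
  define A where "A b = {u \<in> range m. side u = b}" for b
  define N where "N u = {w. (u, w) \<in> D}" for u
  have D_eq: "D = (\<lambda>t. (m t, m (Suc t))) ` {..<n}"
  proof -
    have "(m t, m (Suc t)) = (m (t mod n), m (Suc (t mod n)))" for t
      using periodic[of t] periodic[of "Suc t"] periodic[of "Suc (t mod n)"]
      by (simp add: mod_Suc_eq)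
    then show ?thesis
      unfolding D_def using \<open>0 < n\<close> by (auto intro!: image_eqI[where x = "_ mod n"])
  qed
  have finD: "finite D" and cardD: "card D \<le> n"
    unfolding D_eq using card_image_le[of "{..<n}"] by auto
  have rng: "range m = fst ` D" by (auto simp: D_def image_iff)
  have finA: "finite (A b)" for b
    using finD by (auto simp: A_def rng)
  have swap: "(w, u) \<in> D" if "(u, w) \<in> D" for u w
  proof -
    obtain t where "u = m t" "w = m (Suc t)" using \<open>(u, w) \<in> D\<close> by (auto simp: D_def)
    with two_way[of t] show ?thesis by (auto simp: D_def image_iff) metis
  qed
  have finN: "finite (N u)" for u
    using finD by (intro finite_subset[of "N u" "snd ` D"]) (force simp: N_def)+
  have cardN: "2 \<le> card (N u)" if "u \<in> range m" for u
  proof -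
    from that obtain t where t: "u = m t" by auto
    \<comment> \<open>The step before \<open>t\<close>, taken one period later so that it exists for
      \<open>t = 0\<close>. Its start and \<open>m (Suc t)\<close> are the two neighbours.\<close>
    define r where "r = t + n - 1"
    have r: "Suc r = t + n" "Suc (Suc r) = Suc t + n" using \<open>0 < n\<close> by (simp_all add: r_def)
    have shift: "m (s + n) = m s" for s
      using periodic[of s] periodic[of "s + n"] by simp
    have "m (Suc r) = m t" "m (Suc (Suc r)) = m (Suc t)"
      using shift[of t] shift[of "Suc t"] r by simp_all
    then have "(m r, u) \<in> D" "m r \<noteq> m (Suc t)"
      using nonback[of r] t by (auto simp: D_def image_iff)
    then have "{m r, m (Suc t)} \<subseteq> N u"
      using swap by (auto simp: N_def t D_def)
    then have "card {m r, m (Suc t)} \<le> card (N u)"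
      using finN by (rule card_mono[rotated])
    then show ?thesis using \<open>m r \<noteq> _\<close> by simp
  qed
  have out: "2 * card (A b) \<le> card (SIGMA u:A b. N u)" for b
  proof -
    have "card (A b) * 2 \<le> (\<Sum>u\<in>A b. card (N u))"
      using sum_bounded_below[of "A b" 2 "\<lambda>u. card (N u)"] cardN by (simp add: A_def)
    then show ?thesis using finA finN by (simp add: mult.commute)
  qed
  have split: "D = (SIGMA u:A True. N u) \<union> (SIGMA u:A False. N u)"
    by (auto simp: A_def N_def D_def)
  have in_sides: "side u \<longleftrightarrow> \<not> side w" if "(u, w) \<in> D" for u w
    using that bip by (auto simp: D_def)
  have arcs_from: "(u, w) \<in> (SIGMA u:A b. N u) \<longleftrightarrow> (u, w) \<in> D \<and> side u = b" for u w b
    by (auto simp: A_def N_def D_def)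
  have "prod.swap ` (SIGMA u:A True. N u) = (SIGMA u:A False. N u)"
  proof (rule set_eqI)
    fix z :: "'a \<times> 'a"
    obtain u w where z: "z = (u, w)" by (cases z)
    show "z \<in> prod.swap ` (SIGMA u:A True. N u) \<longleftrightarrow> z \<in> (SIGMA u:A False. N u)"
      unfolding z pair_in_swap_image arcs_from using swap in_sides by blast
  qed
  then have "card (SIGMA u:A True. N u) = card (SIGMA u:A False. N u)"
    by (metis card_image inj_swap)
  moreover have "card D = card (SIGMA u:A True. N u) + card (SIGMA u:A False. N u)"
    unfolding split by (intro card_Un_disjoint finite_SigmaI finA finN) (auto simp: A_def)
  ultimately have two: "card D = 2 * card (SIGMA u:A b. N u)" for b
    by (cases b) auto
  have "\<exists>b. 3 \<le> card (A b)"
    \<comment> \<open>otherwise the walk runs around a 4-cycle, always in the same direction\<close>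
  proof (rule ccontr)
    assume "\<nexists>b. 3 \<le> card (A b)"
    then have small: "card (A b) < 3" for b by (simp add: not_le)
    \<comment> \<open>\<open>m t\<close>, \<open>m (t + 2)\<close> and \<open>m (t + 4)\<close> lie
      on one side, which has fewer than three visited vertices, and consecutive ones differ.\<close>
    have per4: "m (t + 4) = m t" for t
    proof (rule ccontr)
      assume "m (t + 4) \<noteq> m t"
      moreover have "m (t + 2) \<noteq> m t" "m (t + 4) \<noteq> m (t + 2)"
        using nonback[of t] nonback[of "t + 2"] by (simp_all add: eval_nat_numeral)
      ultimately have "card {m t, m (t + 2), m (t + 4)} = 3" by auto
      moreover have "{m t, m (t + 2), m (t + 4)} \<subseteq> A (side (m t))"
        using bip by (auto simp: A_def eval_nat_numeral)
      ultimately have "3 \<le> card (A (side (m t)))"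
        using card_mono[OF finA] by metis
      with small show False by (simp add: not_le[symmetric])
    qed
    have mod4: "m (r + 4 * q) = m r" for q r
    proof (induction q)
      case (Suc q)
      then show ?case using per4[of "r + 4 * q"] by (simp add: algebra_simps)
    qed simp
    \<comment> \<open>The reverse of the first step must occur at some residue \<open>r\<close> mod
      4: the sides exclude 0 and 2, non-backtracking excludes 1 and 3.\<close>
    obtain s where s: "m s = m 1" "m (Suc s) = m 0"
      using two_way[of 0] by auto
    define r where "r = s mod 4"
    have "m s = m r" "m (Suc s) = m (Suc r)"
      using mod4[of r "s div 4"] mod4[of "Suc r" "s div 4"] by (simp_all add: r_def)
    then have r: "m r = m 1" "m (Suc r) = m 0" using s by auto
    have "r < 4" by (simp add: r_def)
    then consider "r = 0" | "r = 1" | "r = 2" | "r = 3" by linarith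
    then show False
      using r bip[of 0] bip[of 1] nonback[of 0] nonback[of 1]
      by cases (auto simp: eval_nat_numeral)
  qed
  then obtain b where "3 \<le> card (A b)" ..
  with out[of b] two[of b] cardD show ?thesis by linarith
qed

section \<open>Adjacency in the grid\<close>

lemma euclidean_distance_eq_1_iff:
  assumes "x \<in> int_lattice n" "y \<in> int_lattice n"
  shows "euclidean_distance n x y = 1 \<longleftrightarrow> (\<exists>i\<in>{1..n}. \<exists>s\<in>{-1, 1}. y = x(i := x i + s))"
proof -
  \<comment> \<open>Squares taken in the naturals, where a sum is 1 only if one term is 1 and all
    others are 0.\<close>
  define f where "f i = (nat \<bar>y i - x i\<bar>)\<^sup>2" for i
  have "euclidean_distance n x y = sqrt (real (\<Sum>i = 1..n. f i))"
    by (auto simp: euclidean_distance_def L2_set_def f_def power2_commute intro!: sum.cong)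
  then have "euclidean_distance n x y = 1 \<longleftrightarrow> (\<Sum>i = 1..n. f i) = 1"
    by (simp only: real_sqrt_eq_1_iff of_nat_eq_1_iff)
  also have "\<dots> \<longleftrightarrow> (\<exists>i\<in>{1..n}. f i = 1 \<and> (\<forall>j\<in>{1..n}. i \<noteq> j \<longrightarrow> f j = 0))"
    by (subst sum_eq_1_iff) auto
  also have "\<dots> \<longleftrightarrow> (\<exists>i\<in>{1..n}. \<bar>y i - x i\<bar> = 1 \<and> (\<forall>j\<in>{1..n}. i \<noteq> j \<longrightarrow> y j = x j))"
  proof -
    have "f i = 1 \<longleftrightarrow> \<bar>y i - x i\<bar> = 1" "f i = 0 \<longleftrightarrow> y i = x i" for i
      by (auto simp: f_def)
    then show ?thesis by simp
  qed
  also have "\<dots> \<longleftrightarrow> (\<exists>i\<in>{1..n}. \<exists>s\<in>{-1, 1}. y = x(i := x i + s))"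
  proof (intro bex_cong refl)
    fix i assume i: "i \<in> {1..n}"
    show "(\<bar>y i - x i\<bar> = 1 \<and> (\<forall>j\<in>{1..n}. i \<noteq> j \<longrightarrow> y j = x j)) \<longleftrightarrow> (\<exists>s\<in>{-1, 1}. y = x(i := x i + s))"
    proof
      assume *: "\<bar>y i - x i\<bar> = 1 \<and> (\<forall>j\<in>{1..n}. i \<noteq> j \<longrightarrow> y j = x j)"
      have "y = x(i := x i + (y i - x i))"
      proof
        fix j show "y j = (x(i := x i + (y i - x i))) j"
          using * assms by (cases "j \<in> {1..n}") (auto simp: int_lattice_def PiE_def extensional_def)
      qed
      moreover have "y i - x i \<in> {-1, 1}" using * by auto
      ultimately show "\<exists>s\<in>{-1, 1}. y = x(i := x i + s)" by blast
    qed auto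
  qed
  finally show ?thesis .
qed

section \<open>Labels, and coordinates as edges of K_{k,k}\<close>

locale difference_grid =
  fixes k :: nat and p a :: "nat \<Rightarrow> int"
  assumes k_ge_3: "k \<ge> 3"
    and inj_diff: "inj_on (\<lambda>(i, j). p i - p j) {(i, j). i \<in> {1..2*k} \<and> j \<in> {1..2*k} \<and> i \<noteq> j}"
    and coefficient: "\<And>i j. i \<in> {1..k} \<Longrightarrow> j \<in> {1..k} \<Longrightarrow>
          a (k * (i - 1) + j) = \<bar>p (2 * i) - p (2 * j - 1)\<bar>"
begin

declare One_nat_def [simp del]

abbreviation I where "I \<equiv> {1..2*k}"

abbreviation V where "V \<equiv> level_points (k^2) a (p ` I)"

abbreviation \<Gamma> where "\<Gamma> \<equiv> grid (k^2) \<restriction> V"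

definition level :: "(nat \<Rightarrow> int) \<Rightarrow> int" where
  "level x = (\<Sum>i = 1..k^2. a i * x i)"

text \<open>The projection onto K_{k,k}; meaningful on \<open>V\<close>, where the level is
  \<open>p u\<close> for a unique index \<open>u\<close>.\<close>

definition label :: "(nat \<Rightarrow> int) \<Rightarrow> nat" where
  "label x = inv_into I p (level x)"

text \<open>The index \<open>k * (i - 1) + j\<close> of the edge between \<open>2 * i\<close> and
  \<open>2 * j - 1\<close>, with the ends accepted in either order.\<close>

definition coord :: "nat \<Rightarrow> nat \<Rightarrow> nat" where
  "coord u w = (if even u then k * (u div 2 - 1) + (w + 1) div 2 else k * (w div 2 - 1) + (u + 1) div 2)"

text \<open>The lift of the step from \<open>u\<close> to an adjacent \<open>w\<close>: the sign
  makes the level change by exactly \<open>p w - p u\<close>.\<close>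

definition move :: "(nat \<Rightarrow> int) \<Rightarrow> nat \<Rightarrow> nat \<Rightarrow> nat \<Rightarrow> int" where
  "move x u w = x(coord u w := x (coord u w) + sgn (p w - p u))"

text \<open>The neighbours of \<open>u\<close> in K_{k,k}.\<close>

definition opposite :: "nat \<Rightarrow> nat set" where
  "opposite u = {w \<in> I. even w \<longleftrightarrow> odd u}"

lemma diff_eqD:
  assumes "p i - p j = p i' - p j'" "i \<in> I" "j \<in> I" "i' \<in> I" "j' \<in> I" "i \<noteq> j" "i' \<noteq> j'"
  shows "i = i' \<and> j = j'"
  using inj_onD[OF inj_diff, of "(i, j)" "(i', j')"] assms by auto

text \<open>Equal values at \<open>i \<noteq> j\<close> would give the pairs \<open>(i, j)\<close>
  and \<open>(j, i)\<close> the same difference 0.\<close>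

lemma inj_p: "inj_on p I"
  using diff_eqD by (metis inj_onI)

lemma oppositeD: "w \<in> opposite u \<Longrightarrow> w \<in> I" "w \<in> opposite u \<Longrightarrow> even w \<longleftrightarrow> odd u"
  "w \<in> opposite u \<Longrightarrow> w \<noteq> u"
  by (auto simp: opposite_def)

lemma opposite_sym: "u \<in> I \<Longrightarrow> w \<in> opposite u \<Longrightarrow> u \<in> opposite w"
  by (auto simp: opposite_def)

lemma finite_opposite: "finite (opposite u)"
  by (simp add: opposite_def)

lemma card_opposite: "card (opposite u) = k"
proof (cases "even u")
  case True
  have "bij_betw (\<lambda>j. 2 * j - 1) {1..k} (opposite u)"
    by (rule bij_betw_byWitness[where f' = "\<lambda>w. (w + 1) div 2"])
       (use True in \<open>auto simp: opposite_def elim!: oddE\<close>)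
  then show ?thesis by (metis bij_betw_same_card card_atLeastAtMost diff_Suc_1)
next
  case False
  have "bij_betw (\<lambda>j. 2 * j) {1..k} (opposite u)"
    by (rule bij_betw_byWitness[where f' = "\<lambda>w. w div 2"])
       (use False in \<open>auto simp: opposite_def elim!: evenE\<close>)
  then show ?thesis by (metis bij_betw_same_card card_atLeastAtMost diff_Suc_1)
qed

lemma coord_sym: "w \<in> opposite u \<Longrightarrow> coord w u = coord u w"
  by (auto simp: coord_def opposite_def)

lemma opposite_cases [consumes 2, case_names even odd]:
  assumes "u \<in> I" "w \<in> opposite u"
  obtains i j where "i \<in> {1..k}" "j \<in> {1..k}" "u = 2 * i" "w = 2 * j - 1" "coord u w = k * (i - 1) + j"
  | i j where "i \<in> {1..k}" "j \<in> {1..k}" "w = 2 * i" "u = 2 * j - 1" "coord u w = k * (i - 1) + j"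
proof (cases "even u")
  case True
  then have "odd w" using assms by (simp add: opposite_def)
  with True show ?thesis
    using assms by (intro that(1)[of "u div 2" "(w + 1) div 2"])
      (auto simp: opposite_def coord_def elim!: oddE evenE)
next
  case False
  then have "even w" using assms by (simp add: opposite_def)
  with False show ?thesis
    using assms by (intro that(2)[of "w div 2" "(u + 1) div 2"])
      (auto simp: opposite_def coord_def elim!: oddE evenE)
qed

lemma index_eqD:
  assumes "k * (i - 1) + j = k * (i' - 1) + j'" "i \<in> {1..k}" "j \<in> {1..k}" "i' \<in> {1..k}" "j' \<in> {1..k}"
  shows "i = i' \<and> j = j'"
proof -
  \<comment> \<open>Shifted by one, \<open>j\<close> is a remainder below \<open>k\<close>, so
    division by \<open>k\<close> recovers both indices.\<close>
  have eq: "k * (i - 1) + (j - 1) = k * (i' - 1) + (j' - 1)"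
    using assms by auto
  have "j - 1 < k" "j' - 1 < k" using assms by auto
  then show ?thesis
    using arg_cong[OF eq, of "\<lambda>c. c div k"] arg_cong[OF eq, of "\<lambda>c. c mod k"] assms by auto
qed

text \<open>This keeps crossings of different edges independent: the base-\<open>k\<close> digits of
  a coordinate recover the ends of its edge, up to order.\<close>

lemma coord_eq_iff:
  assumes "u \<in> I" "w \<in> opposite u" "u' \<in> I" "w' \<in> opposite u'"
  shows "coord u w = coord u' w' \<longleftrightarrow> u = u' \<and> w = w' \<or> u = w' \<and> w = u'"
proof
  assume eq: "coord u w = coord u' w'"
  show "u = u' \<and> w = w' \<or> u = w' \<and> w = u'"
    using assms(1,2)
  proof (cases rule: opposite_cases)
    case (even i j)
    note 1 = this
    show ?thesis using assms(3,4) by (cases rule: opposite_cases) (use 1 eq index_eqD in metis)+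
  next
    case (odd i j)
    note 1 = this
    show ?thesis using assms(3,4) by (cases rule: opposite_cases) (use 1 eq index_eqD in metis)+
  qed
qed (use coord_sym assms in auto)

lemma coord_in:
  assumes "u \<in> I" "w \<in> opposite u"
  shows "coord u w \<in> {1..k^2}"
proof -
  have "k * (i - 1) + j \<in> {1..k^2}" if "i \<in> {1..k}" "j \<in> {1..k}" for i j
  proof -
    have "k * (i - 1) + j \<le> k * (i - 1) + k" using that by simp
    also have "\<dots> = k * i" using that by (cases i) auto
    also have "\<dots> \<le> k^2" using that by (simp add: power2_eq_square)
    finally show ?thesis using that by simp
  qed
  with assms show ?thesis by (cases rule: opposite_cases) simp_all
qed

lemma coefficient_coord:
  assumes "u \<in> I" "w \<in> opposite u"
  shows "a (coord u w) = \<bar>p u - p w\<bar>"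
  using assms
proof (cases rule: opposite_cases)
  case (even i j)
  then show ?thesis using coefficient[of i j] by simp
next
  case (odd i j)
  then show ?thesis using coefficient[of i j] by (simp add: abs_minus_commute)
qed

text \<open>Every grid direction thus belongs to an edge, so no neighbour of a point escapes the
  description by moves.\<close>

lemma coord_surj:
  assumes "c \<in> {1..k^2}"
  obtains u w where "u \<in> I" "w \<in> opposite u" "c = coord u w"
proof -
  define q r where "q = (c - 1) div k" and "r = (c - 1) mod k"
  have "c - 1 < k * k" using assms by (auto simp: power2_eq_square)
  then have "q < k" by (simp add: q_def less_mult_imp_div_less)
  moreover have "r < k" using k_ge_3 by (simp add: r_def)
  moreover have "c = k * q + r + 1" using assms by (simp add: q_def r_def)
  ultimately show thesis
    by (intro that[of "2 * (q + 1)" "2 * r + 1"]) (auto simp: opposite_def coord_def)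
qed

section \<open>Grid steps as lifts of edges\<close>

lemma level_upd:
  assumes "c \<in> {1..k^2}"
  shows "level (x(c := x c + s)) = level x + a c * s"
proof -
  have "level (x(c := x c + s)) = (\<Sum>i = 1..k^2. a i * x i + (if i = c then a c * s else 0))"
    unfolding level_def by (intro sum.cong) (auto simp: algebra_simps)
  then show ?thesis using assms by (simp add: sum.distrib level_def)
qed

lemma label_eq: "u \<in> I \<Longrightarrow> level x = p u \<Longrightarrow> label x = u"
  using inj_p by (simp add: label_def)

lemma V_iff: "x \<in> V \<longleftrightarrow> x \<in> int_lattice (k^2) \<and> level x \<in> p ` I"
  by (simp add: level_points_def level_def)

lemma label_in: "x \<in> V \<Longrightarrow> label x \<in> I"
  and level_eq: "x \<in> V \<Longrightarrow> level x = p (label x)"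
  by (simp_all add: V_iff label_def f_inv_into_f inv_into_into del: atLeastAtMost_iff)

lemma level_move:
  assumes "u \<in> I" "w \<in> opposite u" "level x = p u"
  shows "level (move x u w) = p w"
proof -
  have "a (coord u w) * sgn (p w - p u) = p w - p u"
    using coefficient_coord[OF assms(1,2)] by (simp add: abs_minus_commute[of "p u"] abs_mult_sgn)
  then show ?thesis
    using assms coord_in[OF assms(1,2)] by (simp add: move_def level_upd)
qed

lemma move_in:
  assumes "x \<in> V" "w \<in> opposite (label x)"
  shows "move x (label x) w \<in> V" and "label (move x (label x) w) = w"
proof -
  have lev: "level (move x (label x) w) = p w"
    using assms label_in level_eq by (intro level_move) auto
  then show "label (move x (label x) w) = w"
    using assms oppositeD(1) by (intro label_eq) auto
  have "move x (label x) w \<in> int_lattice (k^2)"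
    using assms coord_in[OF label_in[OF assms(1)] assms(2)]
    by (auto simp: move_def V_iff int_lattice_def PiE_def extensional_def)
  then show "move x (label x) w \<in> V"
    using lev oppositeD(1)[OF assms(2)] by (simp add: V_iff del: atLeastAtMost_iff)
qed

lemma dominates_iff:
  "x \<rightarrow>\<^bsub>\<Gamma>\<^esub> y \<longleftrightarrow> x \<in> V \<and> y \<in> V \<and> (\<exists>i\<in>{1..k^2}. \<exists>s\<in>{-1, 1}. y = x(i := x i + s))"
proof -
  have "x \<rightarrow>\<^bsub>\<Gamma>\<^esub> y \<longleftrightarrow> x \<in> V \<and> y \<in> V \<and> euclidean_distance (k^2) x y = 1"
    by (auto simp: arcs_ends_conv grid_def level_points_def image_iff)
  then show ?thesis
    using euclidean_distance_eq_1_iff by (auto simp: level_points_def)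
qed

lemma p_neq: "u \<in> I \<Longrightarrow> w \<in> opposite u \<Longrightarrow> p w \<noteq> p u"
  using inj_p oppositeD by (metis inj_onD)

text \<open>
  Changing a coordinate by \<open>\<plusminus>1\<close> changes the level by a difference of two \<open>p\<close>'s, and as these
  differences are distinct, the new level determines both the coordinate and the sign.
\<close>

lemma dominates_iff_move:
  assumes "x \<in> V"
  shows "x \<rightarrow>\<^bsub>\<Gamma>\<^esub> y \<longleftrightarrow> (\<exists>w\<in>opposite (label x). y = move x (label x) w)"
proof
  let ?u = "label x"
  have u: "?u \<in> I" "level x = p ?u" using assms label_in level_eq by auto
  assume "x \<rightarrow>\<^bsub>\<Gamma>\<^esub> y"
  then obtain c s where c: "c \<in> {1..k^2}" and s: "s \<in> {-1, 1}" and y: "y = x(c := x c + s)"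
    and "y \<in> V" unfolding dominates_iff by blast
  let ?w = "label y"
  have w: "?w \<in> I" "level y = p ?w" using \<open>y \<in> V\<close> label_in level_eq by auto
  \<comment> \<open>The edge owning coordinate \<open>c\<close> is not yet known to join the labels
    of \<open>x\<close> and \<open>y\<close>; comparing differences will force it to.\<close>
  obtain b d where b: "b \<in> I" "d \<in> opposite b" and c_eq: "c = coord b d"
    using coord_surj[OF c] .
  have d: "d \<in> I" "d \<noteq> b" using b oppositeD by auto
  have diff: "p ?w - p ?u = \<bar>p b - p d\<bar> * s"
    using level_upd[OF c, of x s] u w coefficient_coord[OF b] y c_eq by simp
  moreover have "p b \<noteq> p d" using p_neq[OF b] by simp
  ultimately have neq: "?w \<noteq> ?u" using s by auto
  have "p ?w - p ?u = p b - p d \<or> p ?w - p ?u = p d - p b"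
    using diff s by (auto simp: abs_if split: if_splits)
  then have "?w = b \<and> ?u = d \<or> ?w = d \<and> ?u = b"
    using diff_eqD neq u(1) w(1) b(1) d by metis
  then have opp: "?w \<in> opposite ?u" and c_eq': "c = coord ?u ?w"
    using b opposite_sym coord_sym c_eq by auto
  have s_eq: "s = sgn (p ?w - p ?u)"
    using diff s \<open>p b \<noteq> p d\<close> by (auto simp: sgn_mult)
  have "y = move x ?u ?w"
    unfolding move_def c_eq'[symmetric] s_eq[symmetric] by (rule y)
  with opp show "\<exists>w\<in>opposite ?u. y = move x ?u w"
    by blast
next
  assume "\<exists>w\<in>opposite (label x). y = move x (label x) w"
  then obtain w where w: "w \<in> opposite (label x)" and y: "y = move x (label x) w" by auto
  have "sgn (p w - p (label x)) \<in> {-1, 1}"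
    using p_neq[OF label_in[OF assms] w] by (auto simp: sgn_if)
  then show "x \<rightarrow>\<^bsub>\<Gamma>\<^esub> y"
    using assms move_in[OF assms w] coord_in[OF label_in[OF assms] w]
    by (auto simp: dominates_iff y move_def)
qed

section \<open>Regularity\<close>

lemma regular: "regular_graph k \<Gamma>"
  unfolding regular_graph_def
proof (intro ballI)
  fix x assume "x \<in> verts \<Gamma>"
  then have x: "x \<in> V" by (simp add: induce_subgraph_def)
  have eq: "{y. x \<rightarrow>\<^bsub>\<Gamma>\<^esub> y} = move x (label x) ` opposite (label x)"
    using dominates_iff_move[OF x] by auto
  \<comment> \<open>The label of a moved point is the target, so distinct targets give distinct
    neighbours.\<close>
  have "inj_on (move x (label x)) (opposite (label x))"
    using move_in(2)[OF x] by (metis inj_onI)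
  then show "finite {y. x \<rightarrow>\<^bsub>\<Gamma>\<^esub> y} \<and> card {y. x \<rightarrow>\<^bsub>\<Gamma>\<^esub> y} = k"
    unfolding eq using finite_opposite card_opposite by (simp add: card_image)
qed

section \<open>Lower bound for the girth\<close>

text \<open>Both moves use one coordinate with opposite signs. Hence labels that backtrack force the
  lattice points to backtrack.\<close>

lemma move_move: "u \<in> I \<Longrightarrow> w \<in> opposite u \<Longrightarrow> move (move x u w) w u = x"
  using coord_sym by (auto simp: move_def fun_eq_iff sgn_if)

lemma wf_digraph: "wf_digraph \<Gamma>"
  by unfold_locales (auto simp: grid_def level_points_def)

lemma cycle_length_ge:
  assumes "pre_digraph.cycle \<Gamma> c" "3 \<le> length c"
  shows "12 \<le> length c"
proof -
  let ?n = "length c"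
  obtain v where v_seq: "(\<forall>t. v t \<rightarrow>\<^bsub>\<Gamma>\<^esub> v (Suc t)) \<and> (\<forall>s t. v s = v t \<longleftrightarrow> s mod ?n = t mod ?n)"
    using wf_digraph.cycle_vertex_sequence[OF wf_digraph assms(1)] ..
  then have step: "v t \<rightarrow>\<^bsub>\<Gamma>\<^esub> v (Suc t)" for t
    by blast
  have eq_iff: "v s = v t \<longleftrightarrow> s mod ?n = t mod ?n" for s t
    using v_seq by blast
  define m where "m t = label (v t)" for t
  have v: "v t \<in> V" for t using step dominates_iff by blast
  have m: "m t \<in> I" for t using label_in v by (simp add: m_def)
  have "\<exists>w\<in>opposite (m t). v (Suc t) = move (v t) (m t) w" for t
    using dominates_iff_move[OF v] step by (simp add: m_def)
  then have opp: "m (Suc t) \<in> opposite (m t)"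
    and moves: "v (Suc t) = move (v t) (m t) (m (Suc t))" for t
    using move_in(2)[OF v] by (metis m_def)+
  show ?thesis
  proof (rule nonbacktracking_two_way_walk_length[where m = m and side = even])
    show "0 < ?n" using assms(2) by linarith
    show "m (t mod ?n) = m t" for t
      using eq_iff[of "t mod ?n" t] by (simp add: m_def)
    show "even (m (Suc t)) \<longleftrightarrow> odd (m t)" for t
      using opp oppositeD(2) by blast
    show "m (Suc (Suc t)) \<noteq> m t" for t
    proof
      assume "m (Suc (Suc t)) = m t"
      \<comment> \<open>The cycle would return after two steps, so its length would divide
        2.\<close>
      then have "v (Suc (Suc t)) = v t"
        using moves[of t] moves[of "Suc t"] move_move[OF m opp] by metis
      then have "?n dvd 2"
        using eq_iff[of "t + 2" t] mod_eq_dvd_iff_nat[of t "t + 2" ?n] by simp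
      then show False using assms(2) by (auto dest: dvd_imp_le)
    qed
    show "\<exists>s. m s = m (Suc t) \<and> m (Suc s) = m t" for t
    proof (rule ccontr)
      assume no_return: "\<nexists>s. m s = m (Suc t) \<and> m (Suc s) = m t"
      define i where "i = coord (m t) (m (Suc t))"
      define \<sigma> where "\<sigma> = sgn (p (m (Suc t)) - p (m t))"
      \<comment> \<open>Coordinate \<open>i\<close> changes only on the edge between
        \<open>m t\<close> and \<open>m (Suc t)\<close>; as this is never crossed back, every change
        has sign \<open>\<sigma>\<close>.\<close>
      have mono: "\<sigma> * v s i \<le> \<sigma> * v (Suc s) i" for s
      proof (cases "coord (m s) (m (Suc s)) = i")
        case True
        then have "m s = m t \<and> m (Suc s) = m (Suc t) \<or> m s = m (Suc t) \<and> m (Suc s) = m t"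
          unfolding i_def using coord_eq_iff[OF m opp m opp] by blast
        then have "m s = m t" "m (Suc s) = m (Suc t)"
          using no_return by blast+
        then show ?thesis
          using moves[of s] by (simp add: move_def i_def \<sigma>_def algebra_simps)
      next
        case False
        then show ?thesis using moves[of s] by (simp add: move_def)
      qed
      \<comment> \<open>Step \<open>t\<close> changes the coordinate strictly, yet it is restored
        after a full period.\<close>
      have "\<sigma> * v t i < \<sigma> * v (Suc t) i"
        using moves[of t] p_neq[OF m opp, of t]
        by (simp add: move_def i_def \<sigma>_def algebra_simps sgn_if)
      also have "\<dots> \<le> \<sigma> * v (t + ?n) i"
        using lift_Suc_mono_le[of "\<lambda>s. \<sigma> * v s i", OF mono] assms(2) by simp
      also have "v (t + ?n) = v t" by (simp add: eq_iff)
      finally show False by simp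
    qed
  qed
qed

section \<open>A cycle of length 12\<close>

text \<open>
  The walk below lies over the subgraph \<open>K\<^bsub>2,3\<^esub>\<close> of the level graph and traverses each of its six
  edges once in either direction, so that all the coordinate changes cancel.
\<close>

lemma ex_cycle_length_12:
  assumes "x \<in> V"
  shows "\<exists>c. pre_digraph.cycle \<Gamma> c \<and> length c = 12"
proof -
  define u where "u = label x"
  have u: "u \<in> I" unfolding u_def using assms by (rule label_in)
  obtain W where W: "W \<subseteq> opposite u" "card W = 3"
    by (rule obtain_subset_with_card_n[of 3 "opposite u"]) (use card_opposite k_ge_3 in auto)
  then obtain w1 w2 w3 where w: "w1 \<in> opposite u" "w2 \<in> opposite u" "w3 \<in> opposite u"
    and w_neq: "w1 \<noteq> w2" "w1 \<noteq> w3" "w2 \<noteq> w3"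
    by (auto simp: card_3_iff)
  \<comment> \<open>A second vertex on the side of \<open>u\<close>, available because
    \<open>w1\<close> has \<open>k\<close> neighbours.\<close>
  have "\<not> opposite w1 \<subseteq> {u}"
    using card_mono[of "{u}" "opposite w1"] card_opposite[of w1] k_ge_3 by auto
  then obtain u' where u': "u' \<in> opposite w1" "u' \<noteq> u" by auto
  have u'I: "u' \<in> I" using u' oppositeD by blast
  have w': "w1 \<in> opposite u'" "w2 \<in> opposite u'" "w3 \<in> opposite u'"
    using w u' by (auto simp: opposite_def)
  note sym = w[THEN opposite_sym[OF u]] w'[THEN opposite_sym[OF u'I]]
  note neq = w[THEN oppositeD(3)] w'[THEN oppositeD(3)]
  \<comment> \<open>The walk alternates between \<open>u\<close> and \<open>u'\<close> while its
    middle vertices run twice through \<open>w1\<close>, \<open>w2\<close>, \<open>w3\<close>. As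
    three is odd, the second round passes each of them in the opposite direction. \<open>v\<close>
    is the lift starting at \<open>x\<close>.\<close>
  define ms where "ms = [u, w1, u', w2, u, w3, u', w1, u, w2, u', w3, u]"
  define v where "v = rec_nat x (\<lambda>t y. move y (ms ! t) (ms ! Suc t))"
  have v_0: "v 0 = x" and v_Suc: "v (Suc t) = move (v t) (ms ! t) (ms ! Suc t)" for t
    by (simp_all add: v_def)
  have upt_12: "[0..<12] = [0, 1, 2, 3, 4, 5, 6, 7, 8, 9, 10, 11]"
    by (simp add: eval_nat_numeral One_nat_def)
  have "list_all (\<lambda>t. ms ! Suc t \<in> opposite (ms ! t)) [0..<12]"
    unfolding ms_def upt_12 by (simp add: One_nat_def w w' sym)
  then have opp: "ms ! Suc t \<in> opposite (ms ! t)" if "t < 12" for t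
    using that by (simp add: list_all_iff)
  have v_in: "t \<le> 12 \<Longrightarrow> v t \<in> V \<and> label (v t) = ms ! t" for t
  proof (induction t)
    case 0
    then show ?case using assms by (simp add: v_0 ms_def u_def)
  next
    case (Suc t)
    then have "v t \<in> V" "ms ! Suc t \<in> opposite (label (v t))" "label (v t) = ms ! t"
      using opp[of t] by auto
    then show ?case using move_in[of "v t" "ms ! Suc t"] by (simp add: v_Suc)
  qed
  define s where "s y w = sgn (p w - p y)" for y w
  have forth: "move z y w = z(coord y w := z (coord y w) + s y w)" for z y w
    by (simp add: move_def s_def)
  \<comment> \<open>A crossing back is written with the increment of the forward crossing, so that
    the two visibly cancel.\<close>
  have back_move: "move z w y = z(coord y w := z (coord y w) - s y w)" if "w \<in> opposite y" for z y w
    using coord_sym[OF that] by (simp add: move_def s_def sgn_if)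
  have nonzero: "s y w \<noteq> 0" if "y \<in> I" "w \<in> opposite y" for y w
    using p_neq[OF that] by (simp add: s_def sgn_if)
  note moves = forth[where y = u] forth[where y = u'] w[THEN back_move] w'[THEN back_move]
  define es where "es = [coord u w1, coord u w2, coord u w3, coord u' w1, coord u' w2, coord u' w3]"
  have "distinct es"
    using u u'I w w' w_neq u'(2) neq neq[symmetric]
    by (simp add: es_def coord_eq_iff del: atLeastAtMost_iff)
  \<comment> \<open>Plain variables for the six coordinates, with inequalities in both orientations,
    let function updates be evaluated by rewriting.\<close>
  then obtain e1 e2 e3 f1 f2 f3 where e: "coord u w1 = e1" "coord u w2 = e2" "coord u w3 = e3"
    "coord u' w1 = f1" "coord u' w2 = f2" "coord u' w3 = f3"
    and dist: "distinct [e1, e2, e3, f1, f2, f3]" unfolding es_def by metis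
  have dist_rev: "distinct [f3, f2, f1, e3, e2, e1]"
    using dist by auto
  note v_eval = v_Suc[unfolded ms_def] v_0 moves e
  have closed: "v 12 = v 0"
  proof
    fix i
    consider "i = e1" | "i = e2" | "i = e3" | "i = f1" | "i = f2" | "i = f3"
      | "i \<noteq> e1" "i \<noteq> e2" "i \<noteq> e3" "i \<noteq> f1" "i \<noteq> f2" "i \<noteq> f3"
      by blast
    then show "v 12 i = v 0 i"
      by cases (use dist dist_rev in \<open>simp_all add: v_eval eval_nat_numeral One_nat_def\<close>)
  qed
  \<comment> \<open>The offset from \<open>x\<close> in the six coordinates concerned. The set of
    nonzero entries gains one element in each of the first six steps and loses one in each of the
    last six, in an order that never repeats a set before the end.\<close>
  define h where "h y = map (\<lambda>i. y i - x i) [e1, e2, e3, f1, f2, f3]" for y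
  have "distinct (map (\<lambda>t. h (v t)) [0, 1, 2, 3, 4, 5, 6, 7, 8, 9, 10, 11])"
    using dist dist_rev w[THEN nonzero[OF u]] w'[THEN nonzero[OF u'I]]
    by (simp add: h_def v_eval eval_nat_numeral One_nat_def)
  then have "distinct (map (\<lambda>t. h (v t)) [0..<12])"
    by (simp add: upt_12)
  then have "inj_on (\<lambda>t. h (v t)) {..<12}"
    by (simp add: distinct_map atLeast0LessThan)
  then have inj: "inj_on v {..<12}"
    by (intro inj_on_imageI2[of h v]) (simp add: comp_def)
  have arcs: "v t \<rightarrow>\<^bsub>\<Gamma>\<^esub> v (Suc t)" if "t < 12" for t
  proof -
    have "v t \<in> V" and label: "label (v t) = ms ! t" using v_in[of t] that by simp_all
    then show ?thesis
      unfolding dominates_iff_move[OF \<open>v t \<in> V\<close>] v_Suc label using opp[OF that] by blast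
  qed
  show ?thesis
    by (rule wf_digraph.cycle_of_vertex_sequence[OF wf_digraph _ arcs closed inj]) simp_all
qed

text \<open>Nonemptiness supplies the starting point of the lifted walk; over an empty graph the
  infimum would be infinite.\<close>

lemma girth_eq_12:
  assumes "V \<noteq> {}"
  shows "girth \<Gamma> = 12"
proof (rule antisym)
  obtain x where "x \<in> V" using assms by blast
  then obtain c where "pre_digraph.cycle \<Gamma> c \<and> length c = 12"
    using ex_cycle_length_12 by blast
  then show "girth \<Gamma> \<le> 12"
    unfolding girth_def by (intro INF_lower2[of c]) (auto simp: numeral_eq_enat)
  show "12 \<le> girth \<Gamma>"
    unfolding girth_def
  proof (rule INF_greatest)
    fix c assume "c \<in> {c. pre_digraph.cycle \<Gamma> c \<and> 3 \<le> length c}"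
    then have "12 \<le> length c" using cycle_length_ge[of c] by simp
    then show "12 \<le> enat (length c)" by (simp add: numeral_eq_enat)
  qed
qed

end

theorem theorem3:
  fixes k :: nat and p a :: "nat \<Rightarrow> int"
  assumes "k \<ge> 3"
    and "\<And>i. i \<in> {1..2*k} \<Longrightarrow> p i > 0"
    and "inj_on (\<lambda>(i, j). p i - p j) {(i, j). i \<in> {1..2*k} \<and> j \<in> {1..2*k} \<and> i \<noteq> j}"
    and "\<And>i j. i \<in> {1..k} \<Longrightarrow> j \<in> {1..k} \<Longrightarrow> a (k * (i - 1) + j) = \<bar>p (2 * i) - p (2 * j - 1)\<bar>"
    and "level_points (k^2) a (p ` {1..2*k}) \<noteq> {}"
  shows "regular_graph k (grid (k^2) \<restriction> level_points (k^2) a (p ` {1..2*k})) \<and>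
         girth (grid (k^2) \<restriction> level_points (k^2) a (p ` {1..2*k})) = 12"
proof -
  interpret difference_grid k p a
    by (rule difference_grid.intro[OF assms(1,3,4)])
  show ?thesis
    using regular girth_eq_12[OF assms(5)] ..
qed

end
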